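(* Fix real numbers $p_0$, $\sigma_v>0$, $\sigma_u>0$ and $\sigma_\varepsilon\ge 0$. Then the privacy-noisy Kyle model with these parameters (defined in the context) has a unique linear equilibrium $(\beta,\lambda)\in\mathbb{R}_{>0}^2$, and it is given by $$\lambda=\frac{\sigma_v}{2\sqrt{\sigma_u^2+\sigma_\varepsilon^2}},\qquad \beta=\frac{\sqrt{\sigma_u^2+\sigma_\varepsilon^2}}{\sigma_v}.$$
   Context: Model. On a probability space there are independent Gaussian random variables $v\sim N(p_0,\sigma_v^2)$ (asset value), $u\sim N(0,\sigma_u^2)$ (noise-trader flow) and $\varepsilon\sim N(0,\sigma_\varepsilon^2)$ (privacy noise), where $u$ is independent of $v$ and $\varepsilon$ is independent of $(v,u)$; if $\sigma_\varepsilon=0$ then $\varepsilon=0$ almost surely. An informed trader observes $v$ and submits an order $x$. Total order flow is $y=x+u$. The market maker observes only $\tilde y=y+\varepsilon=x+u+\varepsilon$ and sets a price $p(\tilde y)$. Linear equilibrium. A linear equilibrium is a pair $(\beta,\lambda)\in\mathbb{R}_{>0}^2$, with associated strategy $x=\beta(v-p_0)$ and pricing rule $p(\tilde y)=p_0+\lambda\tilde y$, such that: (1) (Bayesian rationality of pricing) with $\tilde y=\beta(v-p_0)+u+\varepsilon$, one has $p_0+\lambda\tilde y=\mathbb{E}[v\mid\tilde y]$ almost surely; (2) (best response of the informed trader) given $\lambda$, for each value of $v$ the order $x=\beta(v-p_0)$ maximizes over $x\in\mathbb{R}$ the conditional expected profit $\mathbb{E}[(v-p(\tilde y))\,x\mid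 v]=\mathbb{E}[(v-p_0-\lambda(x+u+\varepsilon))\,x\mid v]$. *)

theory Defs
  imports "HOL-Probability.Probability"
begin

(* The density of N(mu, sigma^2) degenerates at sigma = 0, where the law is the point mass at mu. *)
definition gaussian_rv :: "'a measure \<Rightarrow> ('a \<Rightarrow> real) \<Rightarrow> real \<Rightarrow> real \<Rightarrow> bool" where
  "gaussian_rv M X \<mu> \<sigma> \<longleftrightarrow>
     (if \<sigma> = 0 then X \<in> borel_measurable M \<and> (AE \<omega> in M. X \<omega> = \<mu>)
      else distributed M lborel X (\<lambda>t. ennreal (normal_density \<mu> \<sigma> t)))"

locale kyle_model = prob_space M for M :: "'a measure" +
  fixes p0 \<sigma>v \<sigma>u \<sigma>e :: real and v u \<epsilon> :: "'a \<Rightarrow> real"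
  assumes v_gaussian: "gaussian_rv M v p0 \<sigma>v"
    and u_gaussian: "gaussian_rv M u 0 \<sigma>u"
    and eps_gaussian: "gaussian_rv M \<epsilon> 0 \<sigma>e"
    and u_indep_v: "indep_var borel u borel v"
    (* indep_var needs equal value types, so independence of \<epsilon> from the pair (v, u) is stated
       through the generated sigma-algebras. *)
    and eps_indep_vu:
      "indep_set (sets (vimage_algebra (space M) \<epsilon> borel))
         (sets (vimage_algebra (space M) (\<lambda>\<omega>. (v \<omega>, u \<omega>)) (borel \<Otimes>\<^sub>M borel)))"

(* Conditional expectation given the sigma-algebra generated by a real random variable Y. *)
definition cond_exp_given :: "'a measure \<Rightarrow> ('a \<Rightarrow> real) \<Rightarrow> ('a \<Rightarrow> real) \<Rightarrow> 'a \<Rightarrow> real" where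
  "cond_exp_given M X Y = real_cond_exp M (vimage_algebra (space M) Y borel) X"

definition observed_flow ::
    "real \<Rightarrow> ('a \<Rightarrow> real) \<Rightarrow> ('a \<Rightarrow> real) \<Rightarrow> ('a \<Rightarrow> real) \<Rightarrow> real \<Rightarrow> 'a \<Rightarrow> real" where
  "observed_flow p0 v u \<epsilon> \<beta> \<omega> = \<beta> * (v \<omega> - p0) + u \<omega> + \<epsilon> \<omega>"

definition rational_pricing ::
    "'a measure \<Rightarrow> real \<Rightarrow> ('a \<Rightarrow> real) \<Rightarrow> ('a \<Rightarrow> real) \<Rightarrow> ('a \<Rightarrow> real) \<Rightarrow> real \<Rightarrow> real \<Rightarrow> bool" where
  "rational_pricing M p0 v u \<epsilon> \<beta> l \<longleftrightarrow>
     (AE \<omega> in M. p0 + l * observed_flow p0 v u \<epsilon> \<beta> \<omega>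
                 = cond_exp_given M v (observed_flow p0 v u \<epsilon> \<beta>) \<omega>)"

definition profit ::
    "real \<Rightarrow> ('a \<Rightarrow> real) \<Rightarrow> ('a \<Rightarrow> real) \<Rightarrow> ('a \<Rightarrow> real) \<Rightarrow> real \<Rightarrow> real \<Rightarrow> 'a \<Rightarrow> real" where
  "profit p0 v u \<epsilon> l x \<omega> = (v \<omega> - (p0 + l * (x + u \<omega> + \<epsilon> \<omega>))) * x"

(* G w x stands for E[profit of order x | v = w]. For each x the random variable E[profit | v]
   fixes G _ x only up to null sets of the law of v, and x ranges over an uncountable set, so a
   statement about every w and every x needs a canonical version. Joint continuity selects it:
   since v has full support, at most one continuous G exists. *)
definition conditional_profit ::
    "'a measure \<Rightarrow> real \<Rightarrow> ('a \<Rightarrow> real) \<Rightarrow> ('a \<Rightarrow> real) \<Rightarrow> ('a \<Rightarrow> real) \<Rightarrow> real \<Rightarrow>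
     (real \<Rightarrow> real \<Rightarrow> real) \<Rightarrow> bool" where
  "conditional_profit M p0 v u \<epsilon> l G \<longleftrightarrow>
     continuous_on UNIV (\<lambda>(w, x). G w x) \<and>
     (\<forall>x. AE \<omega> in M. cond_exp_given M (profit p0 v u \<epsilon> l x) v \<omega> = G (v \<omega>) x)"

definition best_response ::
    "'a measure \<Rightarrow> real \<Rightarrow> ('a \<Rightarrow> real) \<Rightarrow> ('a \<Rightarrow> real) \<Rightarrow> ('a \<Rightarrow> real) \<Rightarrow> real \<Rightarrow> real \<Rightarrow> bool" where
  "best_response M p0 v u \<epsilon> \<beta> l \<longleftrightarrow>
     (\<exists>G. conditional_profit M p0 v u \<epsilon> l G \<and> (\<forall>w x. G w x \<le> G w (\<beta> * (w - p0))))"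

definition linear_equilibrium ::
    "'a measure \<Rightarrow> real \<Rightarrow> ('a \<Rightarrow> real) \<Rightarrow> ('a \<Rightarrow> real) \<Rightarrow> ('a \<Rightarrow> real) \<Rightarrow> real \<times> real \<Rightarrow> bool" where
  "linear_equilibrium M p0 v u \<epsilon> = (\<lambda>(\<beta>, l).
     \<beta> > 0 \<and> l > 0 \<and> rational_pricing M p0 v u \<epsilon> \<beta> l \<and> best_response M p0 v u \<epsilon> \<beta> l)"

end

theory Submission
  imports Defs
begin

text \<open>
  The noise \<open>u + \<epsilon>\<close> is normal with variance \<open>\<tau>\<^sup>2 = \<sigma>u\<^sup>2 + \<sigma>e\<^sup>2\<close> and independent of \<open>v\<close>. Completing the
  square in the joint density shows that, for \<open>k = \<beta> \<sigma>v\<^sup>2 / (\<beta>\<^sup>2 \<sigma>v\<^sup>2 + \<tau>\<^sup>2)\<close>, the residual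
  \<open>v - p0 - k y\<close> is independent of the observed flow \<open>y\<close>, so that rational pricing amounts to
  \<open>\<lambda> = k\<close>. The only continuous version of the conditional profit is \<open>(w - p0 - \<lambda> x) x\<close>, whose
  maximiser is \<open>x = (w - p0) / (2 \<lambda>)\<close>, so that best response amounts to \<open>\<beta> = 1 / (2 \<lambda>)\<close>. These
  two equations force \<open>\<beta> \<sigma>v = \<tau>\<close>.
\<close>

section \<open>Independence and conditional expectation\<close>

text \<open>The factors \<open>f\<close> and \<open>g\<close> may be any functions, so a factorised
  integral yields independence before its factors are identified as marginal laws. The total mass
  forces \<open>f (space S) * g (space T) = 1\<close>, so the marginals are \<open>f\<close> and
  \<open>g\<close> up to reciprocal constants that cancel in the product.\<close>

lemma (in prob_space) indep_varI_prod:
  assumes X[measurable]: "random_variable S X" and Y[measurable]: "random_variable T Y"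
    and prod: "\<And>A B. A \<in> sets S \<Longrightarrow> B \<in> sets T \<Longrightarrow>
      emeasure M {\<omega> \<in> space M. X \<omega> \<in> A \<and> Y \<omega> \<in> B} = f A * g B"
  shows "indep_var S X T Y"
proof -
  interpret PX: prob_space "distr M S X" by (rule prob_space_distr) fact
  interpret PY: prob_space "distr M T Y" by (rule prob_space_distr) fact
  have total: "f (space S) * g (space T) = 1"
  proof -
    have "{\<omega> \<in> space M. X \<omega> \<in> space S \<and> Y \<omega> \<in> space T} = space M"
      using measurable_space[OF X] measurable_space[OF Y] by auto
    then show ?thesis using prod[OF sets.top sets.top] by (simp add: emeasure_space_1)
  qed
  have fX: "emeasure (distr M S X) A = f A * g (space T)" if A[measurable]: "A \<in> sets S" for A
  proof -
    have "X -` A \<inter> space M = {\<omega> \<in> space M. X \<omega> \<in> A \<and> Y \<omega> \<in> space T}"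
      using measurable_space[OF Y] by auto
    then show ?thesis using prod[OF A sets.top] by (simp add: emeasure_distr)
  qed
  have gY: "emeasure (distr M T Y) B = f (space S) * g B" if B[measurable]: "B \<in> sets T" for B
  proof -
    have "Y -` B \<inter> space M = {\<omega> \<in> space M. X \<omega> \<in> space S \<and> Y \<omega> \<in> B}"
      using measurable_space[OF X] by auto
    then show ?thesis using prod[OF sets.top B] by (simp add: emeasure_distr)
  qed
  have "distr M S X \<Otimes>\<^sub>M distr M T Y = distr M (S \<Otimes>\<^sub>M T) (\<lambda>\<omega>. (X \<omega>, Y \<omega>))"
  proof (rule pair_measure_eqI)
    show "sigma_finite_measure (distr M S X)" "sigma_finite_measure (distr M T Y)"
      by unfold_locales
    show "sets (distr M S X \<Otimes>\<^sub>M distr M T Y) = sets (distr M (S \<Otimes>\<^sub>M T) (\<lambda>\<omega>. (X \<omega>, Y \<omega>)))"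
      by (simp cong: sets_pair_measure_cong)
    fix A B assume "A \<in> sets (distr M S X)" "B \<in> sets (distr M T Y)"
    then have A[measurable]: "A \<in> sets S" and B[measurable]: "B \<in> sets T" by auto
    have "(\<lambda>\<omega>. (X \<omega>, Y \<omega>)) -` (A \<times> B) \<inter> space M = {\<omega> \<in> space M. X \<omega> \<in> A \<and> Y \<omega> \<in> B}"
      by auto
    then have "emeasure (distr M (S \<Otimes>\<^sub>M T) (\<lambda>\<omega>. (X \<omega>, Y \<omega>))) (A \<times> B) = f A * g B"
      using prod[OF A B] by (simp add: emeasure_distr)
    \<comment> \<open>Multiplying by the total mass 1 supplies the two constants that turn
      \<open>f A\<close> and \<open>g B\<close> into the marginal probabilities.\<close>
    also have "\<dots> = (f A * g B) * (f (space S) * g (space T))"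
      by (simp only: total mult_1_right)
    also have "\<dots> = emeasure (distr M S X) A * emeasure (distr M T Y) B"
      by (simp add: fX[OF A] gY[OF B] ac_simps)
    finally show "emeasure (distr M S X) A * emeasure (distr M T Y) B =
        emeasure (distr M (S \<Otimes>\<^sub>M T) (\<lambda>\<omega>. (X \<omega>, Y \<omega>))) (A \<times> B)" ..
  qed
  then show ?thesis by (simp add: indep_var_distribution_eq)
qed

lemma (in prob_space) finite_measure_subalgebra_vimage:
  assumes "random_variable S Y"
  shows "finite_measure_subalgebra M (vimage_algebra (space M) Y S)"
proof
  show "subalgebra M (vimage_algebra (space M) Y S)"
    using assms by (auto simp: subalgebra_def sets_vimage_algebra2 measurable_space)
qed

text \<open>The independent part averages out, while \<open>h (Y \<omega>)\<close> is measurable for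
  the conditioning sigma-algebra and passes through. Both the pricing rule and the conditional
  profit are obtained from such a splitting.\<close>

lemma (in prob_space) real_cond_exp_indep_add:
  fixes N Y :: "'a \<Rightarrow> real"
  assumes ind: "indep_var borel Y borel N" and N: "integrable M N"
    and h[measurable]: "h \<in> borel_measurable borel" and hY: "integrable M (\<lambda>\<omega>. h (Y \<omega>))"
  shows "AE \<omega> in M. real_cond_exp M (vimage_algebra (space M) Y borel) (\<lambda>\<omega>. N \<omega> + h (Y \<omega>)) \<omega>
    = expectation N + h (Y \<omega>)"
proof -
  have Y[measurable]: "random_variable borel Y" using ind by (rule indep_var_rv1)
  let ?F = "vimage_algebra (space M) Y borel"
  interpret finite_measure_subalgebra M ?F by (rule finite_measure_subalgebra_vimage) fact
  have YF[measurable]: "Y \<in> borel_measurable ?F"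
    by (rule measurable_vimage_algebra1) auto
  have "AE \<omega> in M. real_cond_exp M ?F N \<omega> = expectation N"
  proof (rule real_cond_exp_charact)
    fix A assume "A \<in> sets ?F"
    then obtain B where B[measurable]: "B \<in> sets borel" and A: "A = Y -` B \<inter> space M"
      by (auto simp: sets_vimage_algebra2)
    \<comment> \<open>An event of the sigma-algebra generated by \<open>Y\<close> has an indicator
      that is a function of \<open>Y\<close>, hence independent of \<open>N\<close>; the integral
      over the event is then a product of expectations.\<close>
    have "indep_var borel ((indicator B :: real \<Rightarrow> real) \<circ> Y) borel (id \<circ> N)"
      by (rule indep_var_compose[OF ind]) auto
    then have i: "indep_var borel (\<lambda>\<omega>. indicator B (Y \<omega>) :: real) borel N"
      by (simp add: comp_def)
    have "(\<integral>\<omega>\<in>A. N \<omega> \<partial>M) = (\<integral>\<omega>. indicator B (Y \<omega>) * N \<omega> \<partial>M)"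
      unfolding set_lebesgue_integral_def
      by (rule Bochner_Integration.integral_cong) (auto simp: A indicator_def)
    also have "\<dots> = (\<integral>\<omega>. indicator B (Y \<omega>) \<partial>M) * expectation N"
      by (rule indep_var_lebesgue_integral[OF i _ N])
        (auto intro!: integrable_const_bound[where B=1])
    also have "\<dots> = (\<integral>\<omega>\<in>A. expectation N \<partial>M)"
      unfolding set_lebesgue_integral_def
      by (subst integral_mult_left_zero[symmetric])
        (rule Bochner_Integration.integral_cong, auto simp: A indicator_def)
    finally show "(\<integral>\<omega>\<in>A. N \<omega> \<partial>M) = (\<integral>\<omega>\<in>A. expectation N \<partial>M)" .
  qed (use N in auto)
  moreover have "AE \<omega> in M. real_cond_exp M ?F (\<lambda>\<omega>. h (Y \<omega>)) \<omega> = h (Y \<omega>)"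
    by (rule real_cond_exp_F_meas[OF hY]) measurable
  moreover have "AE \<omega> in M. real_cond_exp M ?F (\<lambda>\<omega>. N \<omega> + h (Y \<omega>)) \<omega>
      = real_cond_exp M ?F N \<omega> + real_cond_exp M ?F (\<lambda>\<omega>. h (Y \<omega>)) \<omega>"
    by (rule real_cond_exp_add[OF N hY])
  ultimately show ?thesis by eventually_elim simp
qed

section \<open>Gaussian random variables\<close>

lemma distributed_normal_integrable:
  assumes "0 < \<sigma>" "distributed M lborel X (\<lambda>t. ennreal (normal_density \<mu> \<sigma> t))"
  shows "integrable M X"
  using distributed_integrable_var[OF assms(2)] integrable_normal_moment_nz_1[OF assms(1)] by simp

text \<open>For independent centred normals \<open>X\<close>, \<open>N\<close>, the left side is the
  joint density of \<open>X\<close> and \<open>b X + N\<close> at \<open>(x, z)\<close>. The right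
  side is the density of \<open>b X + N\<close>, with variance \<open>D\<close>, times the
  conditional density of \<open>X\<close> given \<open>b X + N = z\<close>.\<close>

lemma normal_density_complete_square:
  fixes \<sigma> \<tau> b :: real
  assumes "0 < \<sigma>" "0 < \<tau>"
  defines "D \<equiv> b\<^sup>2 * \<sigma>\<^sup>2 + \<tau>\<^sup>2"
  shows "normal_density 0 \<sigma> x * normal_density 0 \<tau> (z - b * x)
    = normal_density 0 (sqrt D) z * normal_density 0 (\<sigma> * \<tau> / sqrt D) (x - b * \<sigma>\<^sup>2 / D * z)"
proof -
  have D: "D > 0" unfolding D_def using assms by (simp add: add_nonneg_pos)
  \<comment> \<open>The normalising constants match because the standard deviations on either side
    multiply to \<open>\<sigma> * \<tau>\<close>.\<close>
  have c: "sqrt (2 * pi * \<sigma>\<^sup>2) * sqrt (2 * pi * \<tau>\<^sup>2)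
      = sqrt (2 * pi * (sqrt D)\<^sup>2) * sqrt (2 * pi * (\<sigma> * \<tau> / sqrt D)\<^sup>2)"
    unfolding real_sqrt_mult[symmetric] using D
    by (simp add: power_mult_distrib power_divide field_simps)
  have e: "- (x - 0)\<^sup>2 / (2 * \<sigma>\<^sup>2) + - (z - b * x - 0)\<^sup>2 / (2 * \<tau>\<^sup>2)
      = - (z - 0)\<^sup>2 / (2 * (sqrt D)\<^sup>2)
        + - (x - b * \<sigma>\<^sup>2 / D * z - 0)\<^sup>2 / (2 * (\<sigma> * \<tau> / sqrt D)\<^sup>2)"
  proof -
    have "- (z - 0)\<^sup>2 / (2 * (sqrt D)\<^sup>2)
        + - (x - b * \<sigma>\<^sup>2 / D * z - 0)\<^sup>2 / (2 * (\<sigma> * \<tau> / sqrt D)\<^sup>2)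
      = - (\<sigma>\<^sup>2 * \<tau>\<^sup>2 * z\<^sup>2 + (D * x - b * \<sigma>\<^sup>2 * z)\<^sup>2) / (2 * D * \<sigma>\<^sup>2 * \<tau>\<^sup>2)"
      using D assms(1,2) by (simp add: power_mult_distrib power_divide divide_simps)
        (simp add: power2_eq_square algebra_simps)
    \<comment> \<open>Both sides expand to \<open>D * (D * x\<^sup>2 - 2 * b * \<sigma>\<^sup>2 * x
      * z + \<sigma>\<^sup>2 * z\<^sup>2)\<close>; the factor \<open>D\<close> then cancels.\<close>
    also have "\<sigma>\<^sup>2 * \<tau>\<^sup>2 * z\<^sup>2 + (D * x - b * \<sigma>\<^sup>2 * z)\<^sup>2 = D * (\<tau>\<^sup>2 * x\<^sup>2 + \<sigma>\<^sup>2 * (z - b * x)\<^sup>2)"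
      unfolding D_def by (simp add: power2_eq_square algebra_simps)
    also have "- (D * (\<tau>\<^sup>2 * x\<^sup>2 + \<sigma>\<^sup>2 * (z - b * x)\<^sup>2)) / (2 * D * \<sigma>\<^sup>2 * \<tau>\<^sup>2)
        = - (x - 0)\<^sup>2 / (2 * \<sigma>\<^sup>2) + - (z - b * x - 0)\<^sup>2 / (2 * \<tau>\<^sup>2)"
      using D assms(1,2) by (simp add: divide_simps)
    finally show ?thesis ..
  qed
  have m: "1 / p * exp x * (1 / q * exp y) = exp (x + y) / (p * q)" for p q x y :: real
    by (simp add: exp_add)
  show ?thesis
    unfolding normal_density_def m c e ..
qed

text \<open>The slope \<open>k\<close> is the covariance of \<open>X\<close> with
  \<open>b X + N\<close> over the variance of \<open>b X + N\<close>, so the residual is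
  uncorrelated with the observation. For jointly normal variables this gives independence, visible
  here as a factorisation of the joint density.\<close>

lemma (in prob_space) normal_regression_residual_indep:
  fixes X N :: "'a \<Rightarrow> real" and b :: real
  assumes \<sigma>: "0 < \<sigma>" and \<tau>: "0 < \<tau>"
    and X: "distributed M lborel X (\<lambda>t. ennreal (normal_density 0 \<sigma> t))"
    and N: "distributed M lborel N (\<lambda>t. ennreal (normal_density 0 \<tau> t))"
    and ind: "indep_var borel X borel N"
  defines "k \<equiv> b * \<sigma>\<^sup>2 / (b\<^sup>2 * \<sigma>\<^sup>2 + \<tau>\<^sup>2)"
  shows "indep_var borel (\<lambda>\<omega>. b * X \<omega> + N \<omega>) borel (\<lambda>\<omega>. X \<omega> - k * (b * X \<omega> + N \<omega>))"
proof -
  have [measurable]: "X \<in> borel_measurable M" "N \<in> borel_measurable M"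
    using distributed_measurable[OF X] distributed_measurable[OF N] by auto
  define s where "s = sqrt (b\<^sup>2 * \<sigma>\<^sup>2 + \<tau>\<^sup>2)"
  define r where "r = \<sigma> * \<tau> / s"
  have sq: "normal_density 0 \<sigma> x * normal_density 0 \<tau> (z - b * x)
      = normal_density 0 s z * normal_density 0 r (x - k * z)" for x z
    using normal_density_complete_square[OF \<sigma> \<tau>, of x z b] by (simp add: s_def r_def k_def)
  have ind': "indep_var lborel X lborel N"
    using ind by (simp add: indep_var_eq)
  have joint: "distributed M (lborel \<Otimes>\<^sub>M lborel) (\<lambda>\<omega>. (X \<omega>, N \<omega>))
      (\<lambda>(x, y). ennreal (normal_density 0 \<sigma> x) * ennreal (normal_density 0 \<tau> y))"
    by (rule distributed_joint_indep[OF _ _ X N ind']) unfold_locales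
  show ?thesis
  proof (rule indep_varI_prod)
    fix B A :: "real set"
    assume [measurable]: "B \<in> sets borel" "A \<in> sets borel"
    let ?g = "\<lambda>(x, y). indicator A (x - k * (b * x + y)) * indicator B (b * x + y) :: ennreal"
    have "emeasure M {\<omega> \<in> space M. b * X \<omega> + N \<omega> \<in> B \<and> X \<omega> - k * (b * X \<omega> + N \<omega>) \<in> A}
        = (\<integral>\<^sup>+\<omega>. ?g (X \<omega>, N \<omega>) \<partial>M)"
      by (subst nn_integral_indicator[symmetric], measurable)
        (rule nn_integral_cong, auto simp: indicator_def)
    also have "\<dots> = (\<integral>\<^sup>+p. (case p of (x, y) \<Rightarrow>
        ennreal (normal_density 0 \<sigma> x) * ennreal (normal_density 0 \<tau> y)) * ?g p
        \<partial>(lborel \<Otimes>\<^sub>M lborel))"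
      by (rule distributed_nn_integral[OF joint, symmetric]) measurable
    also have "\<dots> = (\<integral>\<^sup>+x. \<integral>\<^sup>+y. ennreal (normal_density 0 \<sigma> x) * ennreal (normal_density 0 \<tau> y)
        * ?g (x, y) \<partial>lborel \<partial>lborel)"
      by (subst lborel.nn_integral_fst[symmetric]) (auto simp: case_prod_beta)
    \<comment> \<open>For fixed \<open>x\<close>, the translation \<open>y = z - b * x\<close> makes
      the observation itself the inner variable.\<close>
    also have "\<dots> = (\<integral>\<^sup>+x. \<integral>\<^sup>+z. ennreal (normal_density 0 \<sigma> x * normal_density 0 \<tau> (z - b * x))
        * (indicator A (x - k * z) * indicator B z) \<partial>lborel \<partial>lborel)"
    proof (rule nn_integral_cong)
      fix x :: real
      show "(\<integral>\<^sup>+y. ennreal (normal_density 0 \<sigma> x) * ennreal (normal_density 0 \<tau> y)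
          * ?g (x, y) \<partial>lborel)
        = (\<integral>\<^sup>+z. ennreal (normal_density 0 \<sigma> x * normal_density 0 \<tau> (z - b * x))
          * (indicator A (x - k * z) * indicator B z) \<partial>lborel)"
        by (subst nn_integral_real_affine[where t="- b * x" and c=1])
          (auto simp: ennreal_mult intro!: nn_integral_cong)
    qed
    also have "\<dots> = (\<integral>\<^sup>+x. \<integral>\<^sup>+z. ennreal (normal_density 0 s z) * indicator B z
        * (ennreal (normal_density 0 r (x - k * z)) * indicator A (x - k * z)) \<partial>lborel \<partial>lborel)"
      unfolding sq by (simp add: ennreal_mult ac_simps)
    \<comment> \<open>With \<open>x\<close> innermost, translating it by \<open>k * z\<close>
      removes \<open>z\<close> from the inner integral, which can then be pulled out as a
      constant.\<close>
    also have "\<dots> = (\<integral>\<^sup>+z. \<integral>\<^sup>+x. ennreal (normal_density 0 s z) * indicator B z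
        * (ennreal (normal_density 0 r (x - k * z)) * indicator A (x - k * z)) \<partial>lborel \<partial>lborel)"
      by (rule lborel_pair.Fubini') measurable
    also have "\<dots> = (\<integral>\<^sup>+z. ennreal (normal_density 0 s z) * indicator B z
        * (\<integral>\<^sup>+x. ennreal (normal_density 0 r x) * indicator A x \<partial>lborel) \<partial>lborel)"
    proof (rule nn_integral_cong)
      fix z :: real
      have "(\<integral>\<^sup>+x. ennreal (normal_density 0 r (x - k * z)) * indicator A (x - k * z) \<partial>lborel)
          = (\<integral>\<^sup>+x. ennreal (normal_density 0 r x) * indicator A x \<partial>lborel)"
        by (subst nn_integral_real_affine[where t="k * z" and c=1]) auto
      then show "(\<integral>\<^sup>+x. ennreal (normal_density 0 s z) * indicator B z
          * (ennreal (normal_density 0 r (x - k * z)) * indicator A (x - k * z)) \<partial>lborel)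
        = ennreal (normal_density 0 s z) * indicator B z
          * (\<integral>\<^sup>+x. ennreal (normal_density 0 r x) * indicator A x \<partial>lborel)"
        by (subst nn_integral_cmult) auto
    qed
    also have "\<dots> = (\<integral>\<^sup>+z. ennreal (normal_density 0 s z) * indicator B z \<partial>lborel)
        * (\<integral>\<^sup>+x. ennreal (normal_density 0 r x) * indicator A x \<partial>lborel)"
      by (rule nn_integral_multc) measurable
    finally show "emeasure M {\<omega> \<in> space M. b * X \<omega> + N \<omega> \<in> B \<and> X \<omega> - k * (b * X \<omega> + N \<omega>) \<in> A}
      = (\<integral>\<^sup>+z. ennreal (normal_density 0 s z) * indicator B z \<partial>lborel)
        * (\<integral>\<^sup>+x. ennreal (normal_density 0 r x) * indicator A x \<partial>lborel)" .
  qed measurable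
qed

text \<open>Besides the usual convolution of normal laws this covers \<open>\<tau> = 0\<close>,
  where the second summand vanishes almost surely; it is what admits a model with no privacy
  noise.\<close>

lemma (in prob_space) add_indep_gaussian_rv:
  fixes X N :: "'a \<Rightarrow> real"
  assumes "0 < \<sigma>" "0 \<le> \<tau>" and X: "gaussian_rv M X 0 \<sigma>" and N: "gaussian_rv M N 0 \<tau>"
    and ind: "indep_var borel X borel N"
  shows "distributed M lborel (\<lambda>\<omega>. X \<omega> + N \<omega>)
    (\<lambda>t. ennreal (normal_density 0 (sqrt (\<sigma>\<^sup>2 + \<tau>\<^sup>2)) t))"
proof (cases "\<tau> = 0")
  case False
  then show ?thesis
    using assms add_indep_normal[OF ind, of \<sigma> \<tau> 0 0] by (simp add: gaussian_rv_def)
next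
  case True
  have DX: "distributed M lborel X (\<lambda>t. ennreal (normal_density 0 \<sigma> t))"
    using X \<open>0 < \<sigma>\<close> by (simp add: gaussian_rv_def)
  have [measurable]: "X \<in> borel_measurable M" "N \<in> borel_measurable M"
    using ind by (rule indep_var_rv1, rule indep_var_rv2)
  have "AE \<omega> in M. X \<omega> + N \<omega> = X \<omega>"
    using N True by (simp add: gaussian_rv_def)
  then have "distr M lborel (\<lambda>\<omega>. X \<omega> + N \<omega>) = distr M lborel X"
    by (intro distr_cong_AE) auto
  then show ?thesis
    using DX True \<open>0 < \<sigma>\<close> by (simp add: distributed_def)
qed

text \<open>A normal density is positive everywhere, so null sets of the law are Lebesgue null. The
  set where \<open>f\<close> and \<open>g\<close> agree is closed and has full Lebesgue measure,
  hence is the whole line.\<close>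

lemma normal_AE_continuous_eq:
  fixes f g :: "real \<Rightarrow> real"
  assumes "0 < \<sigma>" and X: "distributed M lborel X (\<lambda>t. ennreal (normal_density \<mu> \<sigma> t))"
    and f: "continuous_on UNIV f" and g: "continuous_on UNIV g"
    and ae: "AE \<omega> in M. f (X \<omega>) = g (X \<omega>)"
  shows "f = g"
proof -
  have [measurable]: "f \<in> borel_measurable borel" "g \<in> borel_measurable borel"
    using f g by (auto intro: borel_measurable_continuous_onI)
  have [measurable]: "X \<in> borel_measurable M" using distributed_measurable[OF X] by simp
  have "AE t in distr M lborel X. f t = g t"
    using ae by (subst AE_distr_iff) simp_all
  then have "AE t in lborel. 0 < ennreal (normal_density \<mu> \<sigma> t) \<longrightarrow> f t = g t"
    unfolding distributed_distr_eq_density[OF X] by (subst (asm) AE_density) simp_all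
  then have "AE t in lborel. f t = g t"
    by (simp add: normal_density_pos[OF \<open>0 < \<sigma>\<close>])
  then have "AE t in lebesgue. t \<in> {t. f t = g t}"
    by (simp add: AE_completion)
  moreover have "closed {t. f t = g t}"
    by (rule closed_Collect_eq[OF f g])
  ultimately have "t \<in> {t. f t = g t}" for t
    by (rule mem_closed_if_AE_lebesgue[rotated])
  then show ?thesis by auto
qed

section \<open>The Kyle model with a noisily observed order flow\<close>

context kyle_model
begin

section \<open>Mutual independence of value, noise-trader flow and privacy noise\<close>

lemma v_u_eps_measurable [measurable]:
  "v \<in> borel_measurable M" "u \<in> borel_measurable M" "\<epsilon> \<in> borel_measurable M"
proof -
  show "v \<in> borel_measurable M" "u \<in> borel_measurable M"
    using u_indep_v by (auto dest: indep_var_rv1 indep_var_rv2)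
  show "\<epsilon> \<in> borel_measurable M"
    using eps_gaussian distributed_measurable[of M lborel \<epsilon>]
    by (auto simp: gaussian_rv_def split: if_splits)
qed

text \<open>The event splits in two stages: first \<open>\<epsilon>\<close> against the rectangle
  \<open>A \<times> B\<close> for the pair \<open>(v, u)\<close>, then \<open>v\<close> against
  \<open>u\<close>.\<close>

lemma prob_v_u_eps:
  assumes [measurable]: "A \<in> sets borel" "B \<in> sets borel" "C \<in> sets borel"
  shows "prob {\<omega> \<in> space M. v \<omega> \<in> A \<and> u \<omega> \<in> B \<and> \<epsilon> \<omega> \<in> C}
    = prob {\<omega> \<in> space M. v \<omega> \<in> A} * prob {\<omega> \<in> space M. u \<omega> \<in> B} * prob {\<omega> \<in> space M. \<epsilon> \<omega> \<in> C}"
proof -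
  let ?E = "{\<omega> \<in> space M. \<epsilon> \<omega> \<in> C}" and ?F = "{\<omega> \<in> space M. v \<omega> \<in> A \<and> u \<omega> \<in> B}"
  have "?E = \<epsilon> -` C \<inter> space M" by auto
  then have E: "?E \<in> sets (vimage_algebra (space M) \<epsilon> borel)"
    by (auto intro: in_vimage_algebra)
  have "?F = (\<lambda>\<omega>. (v \<omega>, u \<omega>)) -` (A \<times> B) \<inter> space M" by auto
  then have F: "?F \<in> sets (vimage_algebra (space M) (\<lambda>\<omega>. (v \<omega>, u \<omega>)) (borel \<Otimes>\<^sub>M borel))"
    by (auto intro: in_vimage_algebra)
  have "{\<omega> \<in> space M. v \<omega> \<in> A \<and> u \<omega> \<in> B \<and> \<epsilon> \<omega> \<in> C} = ?E \<inter> ?F" by auto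
  then have "prob {\<omega> \<in> space M. v \<omega> \<in> A \<and> u \<omega> \<in> B \<and> \<epsilon> \<omega> \<in> C} = prob ?E * prob ?F"
    using indep_setD[OF eps_indep_vu E F] by simp
  moreover have "prob ?F = prob {\<omega> \<in> space M. v \<omega> \<in> A} * prob {\<omega> \<in> space M. u \<omega> \<in> B}"
    using indep_varD[OF u_indep_v, of B A]
    by (simp add: vimage_def Int_def conj_commute mult.commute conj_ac)
  ultimately show ?thesis by simp
qed

lemma indep_vars_v_u_eps:
  "indep_vars (\<lambda>_. borel) (\<lambda>i::nat. [v, u, \<epsilon>] ! i) {0, 1, 2}"
\<comment> \<open>The Borel sigma-algebra serves as its own intersection-stable generator, which
  leaves the product formula for all three indices.\<close>
proof (subst indep_vars_finite[where E="\<lambda>_. sets borel"])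
  show "\<forall>A\<in>{0, 1, 2} \<rightarrow> sets borel.
      prob (\<Inter>j\<in>{0, 1, 2::nat}. ([v, u, \<epsilon>] ! j) -` A j \<inter> space M)
      = (\<Prod>j\<in>{0, 1, 2}. prob (([v, u, \<epsilon>] ! j) -` A j \<inter> space M))"
  proof
    fix A :: "nat \<Rightarrow> real set" assume "A \<in> {0, 1, 2} \<rightarrow> sets borel"
    then have A: "A 0 \<in> sets borel" "A 1 \<in> sets borel" "A 2 \<in> sets borel" by auto
    have "(\<Inter>j\<in>{0, 1, 2::nat}. ([v, u, \<epsilon>] ! j) -` A j \<inter> space M)
        = {\<omega> \<in> space M. v \<omega> \<in> A 0 \<and> u \<omega> \<in> A 1 \<and> \<epsilon> \<omega> \<in> A 2}"
      by auto
    then show "prob (\<Inter>j\<in>{0, 1, 2::nat}. ([v, u, \<epsilon>] ! j) -` A j \<inter> space M)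
        = (\<Prod>j\<in>{0, 1, 2}. prob (([v, u, \<epsilon>] ! j) -` A j \<inter> space M))"
      using prob_v_u_eps[OF A] by (simp add: vimage_def Int_def conj_commute)
  qed
qed (auto simp: sets.Int_stable sets.sigma_sets_eq[of borel, simplified] dest: sets.sets_into_space)

text \<open>An instance of independence of one variable from a sum of others, where the sum over the
  singleton \<open>{2}\<close> is just \<open>\<epsilon>\<close>.\<close>

lemma indep_u_eps: "indep_var borel u borel \<epsilon>"
  using indep_vars_sum[of "{2}" 1 "\<lambda>i::nat. [v, u, \<epsilon>] ! i"]
    indep_vars_subset[OF indep_vars_v_u_eps, of "{1, 2}"]
  by simp

lemma indep_v_noise: "indep_var borel v borel (\<lambda>\<omega>. u \<omega> + \<epsilon> \<omega>)"
  using indep_vars_sum[of "{1, 2}" 0 "\<lambda>i::nat. [v, u, \<epsilon>] ! i"] indep_vars_v_u_eps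
  by simp

end

locale nondegenerate_kyle_model = kyle_model +
  assumes \<sigma>v: "0 < \<sigma>v" and \<sigma>u: "0 < \<sigma>u" and \<sigma>e: "0 \<le> \<sigma>e"
begin

definition \<tau> :: real where "\<tau> = sqrt (\<sigma>u\<^sup>2 + \<sigma>e\<^sup>2)"

lemma \<tau>_pos: "0 < \<tau>"
  using \<sigma>u unfolding \<tau>_def by (simp add: add_pos_nonneg)

lemma v_distributed: "distributed M lborel v (\<lambda>t. ennreal (normal_density p0 \<sigma>v t))"
  using v_gaussian \<sigma>v by (simp add: gaussian_rv_def)

lemma v_centered_distributed:
  "distributed M lborel (\<lambda>\<omega>. v \<omega> - p0) (\<lambda>t. ennreal (normal_density 0 \<sigma>v t))"
  using normal_density_affine[OF v_distributed \<sigma>v, of 1 "- p0"] by simp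

lemma noise_distributed:
  "distributed M lborel (\<lambda>\<omega>. u \<omega> + \<epsilon> \<omega>) (\<lambda>t. ennreal (normal_density 0 \<tau> t))"
  unfolding \<tau>_def
  by (rule add_indep_gaussian_rv[OF \<sigma>u \<sigma>e u_gaussian eps_gaussian indep_u_eps])

lemma integrable_v [simp, intro]: "integrable M v"
  by (rule distributed_normal_integrable[OF \<sigma>v v_distributed])

lemma integrable_noise [simp, intro]: "integrable M (\<lambda>\<omega>. u \<omega> + \<epsilon> \<omega>)"
  by (rule distributed_normal_integrable[OF \<tau>_pos noise_distributed])

lemma expectation_noise: "expectation (\<lambda>\<omega>. u \<omega> + \<epsilon> \<omega>) = 0"
  by (rule normal_distributed_expectation[OF \<tau>_pos noise_distributed])

lemma indep_v_centered_noise: "indep_var borel (\<lambda>\<omega>. v \<omega> - p0) borel (\<lambda>\<omega>. u \<omega> + \<epsilon> \<omega>)"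
  using indep_var_compose[OF indep_v_noise, of "\<lambda>t. t - p0" borel id borel]
  by (simp add: comp_def)

section \<open>The observed flow and rational pricing\<close>

lemma observed_flow_eq:
  "observed_flow p0 v u \<epsilon> \<beta> = (\<lambda>\<omega>. \<beta> * (v \<omega> - p0) + (u \<omega> + \<epsilon> \<omega>))"
  by (simp add: observed_flow_def fun_eq_iff)

lemma integrable_flow: "integrable M (observed_flow p0 v u \<epsilon> \<beta>)"
  unfolding observed_flow_eq
  by (rule Bochner_Integration.integrable_add[OF _ integrable_noise]) simp

lemma expectation_flow: "expectation (observed_flow p0 v u \<epsilon> \<beta>) = 0"
  unfolding observed_flow_eq
  using normal_distributed_expectation[OF \<sigma>v v_distributed] expectation_noise
  by (subst Bochner_Integration.integral_add) (auto simp: prob_space)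

text \<open>Write \<open>v\<close> as the regression residual plus an affine function of the flow.
  The residual is independent of the flow and has mean zero, so only the affine function
  survives.\<close>

lemma cond_exp_v_given_flow:
  "AE \<omega> in M. cond_exp_given M v (observed_flow p0 v u \<epsilon> \<beta>) \<omega>
    = p0 + \<beta> * \<sigma>v\<^sup>2 / (\<beta>\<^sup>2 * \<sigma>v\<^sup>2 + \<tau>\<^sup>2) * observed_flow p0 v u \<epsilon> \<beta> \<omega>"
proof -
  let ?Y = "observed_flow p0 v u \<epsilon> \<beta>"
  define k where "k = \<beta> * \<sigma>v\<^sup>2 / (\<beta>\<^sup>2 * \<sigma>v\<^sup>2 + \<tau>\<^sup>2)"
  let ?Z = "\<lambda>\<omega>. (v \<omega> - p0) - k * ?Y \<omega>"
  have ind: "indep_var borel ?Y borel ?Z"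
    using normal_regression_residual_indep[OF \<sigma>v \<tau>_pos v_centered_distributed noise_distributed
        indep_v_centered_noise, of \<beta>]
    by (simp add: observed_flow_eq k_def)
  have Z: "integrable M ?Z" and h: "integrable M (\<lambda>\<omega>. p0 + k * ?Y \<omega>)"
    using integrable_flow by auto
  have "expectation ?Z = 0"
    using normal_distributed_expectation[OF \<sigma>v v_distributed] integrable_flow
    by (simp add: expectation_flow prob_space)
  then show ?thesis
    using real_cond_exp_indep_add[OF ind Z _ h] by (simp add: cond_exp_given_def k_def)
qed

text \<open>The flow has a density, so it has no atom at 0. This permits dividing by the flow when
  two pricing slopes are compared.\<close>

lemma flow_nonzero:
  assumes "\<beta> > 0"
  shows "AE \<omega> in M. observed_flow p0 v u \<epsilon> \<beta> \<omega> \<noteq> 0"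
proof -
  let ?Y = "observed_flow p0 v u \<epsilon> \<beta>"
  have "distributed M lborel (\<lambda>\<omega>. \<beta> * (v \<omega> - p0))
      (\<lambda>t. ennreal (normal_density 0 (\<beta> * \<sigma>v) t))"
    using normal_density_affine[OF v_centered_distributed \<sigma>v, of \<beta> 0] assms by simp
  moreover have "indep_var borel (\<lambda>\<omega>. \<beta> * (v \<omega> - p0)) borel (\<lambda>\<omega>. u \<omega> + \<epsilon> \<omega>)"
    using indep_var_compose[OF indep_v_noise, of "\<lambda>t. \<beta> * (t - p0)" borel id borel]
    by (simp add: comp_def)
  ultimately have Y: "distributed M lborel ?Y
      (\<lambda>t. ennreal (normal_density 0 (sqrt ((\<beta> * \<sigma>v)\<^sup>2 + \<tau>\<^sup>2)) t))"
    using add_indep_normal[of _ _ "\<beta> * \<sigma>v" \<tau> 0 0] noise_distributed assms \<sigma>v \<tau>_pos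
    by (simp add: observed_flow_eq)
  have "AE t in distr M lborel ?Y. t \<noteq> 0"
    unfolding distributed_distr_eq_density[OF Y]
    using AE_lborel_singleton[of "0::real"] by (subst AE_density) auto
  then show ?thesis
    by (rule AE_distrD[OF distributed_measurable[OF Y]])
qed

lemma rational_pricing_iff:
  assumes "\<beta> > 0"
  shows "rational_pricing M p0 v u \<epsilon> \<beta> l \<longleftrightarrow> l = \<beta> * \<sigma>v\<^sup>2 / (\<beta>\<^sup>2 * \<sigma>v\<^sup>2 + \<tau>\<^sup>2)"
proof
  assume "rational_pricing M p0 v u \<epsilon> \<beta> l"
  \<comment> \<open>Cancelling \<open>p0\<close> and the nonzero flow leaves an equation free of
    \<open>\<omega>\<close>; on a probability space, holding almost surely then means
    holding.\<close>
  then have "AE \<omega> in M. l = \<beta> * \<sigma>v\<^sup>2 / (\<beta>\<^sup>2 * \<sigma>v\<^sup>2 + \<tau>\<^sup>2)"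
    unfolding rational_pricing_def using cond_exp_v_given_flow[of \<beta>] flow_nonzero[OF assms]
    by eventually_elim (simp del: times_divide_eq_left)
  then show "l = \<beta> * \<sigma>v\<^sup>2 / (\<beta>\<^sup>2 * \<sigma>v\<^sup>2 + \<tau>\<^sup>2)" by simp
next
  assume "l = \<beta> * \<sigma>v\<^sup>2 / (\<beta>\<^sup>2 * \<sigma>v\<^sup>2 + \<tau>\<^sup>2)"
  then show "rational_pricing M p0 v u \<epsilon> \<beta> l"
    unfolding rational_pricing_def using cond_exp_v_given_flow[of \<beta>]
    by (auto elim: eventually_mono)
qed

section \<open>Conditional profit and the best response\<close>

lemma cond_exp_profit_given_v:
  "AE \<omega> in M. cond_exp_given M (profit p0 v u \<epsilon> l x) v \<omega> = (v \<omega> - p0 - l * x) * x"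
proof -
  let ?N = "\<lambda>\<omega>. - l * x * (u \<omega> + \<epsilon> \<omega>)" and ?h = "\<lambda>w. (w - p0 - l * x) * x"
  have ind: "indep_var borel v borel ?N"
    using indep_var_compose[OF indep_v_noise, of id borel "\<lambda>t. - l * x * t" borel]
    by (simp add: comp_def)
  have N: "integrable M ?N" and h: "integrable M (\<lambda>\<omega>. ?h (v \<omega>))" by auto
  \<comment> \<open>Profit is affine in the noise with the constant slope \<open>- l * x\<close>;
    the remainder depends on \<open>v\<close> alone, and the noise has mean zero.\<close>
  have "profit p0 v u \<epsilon> l x = (\<lambda>\<omega>. ?N \<omega> + ?h (v \<omega>))"
    by (simp add: profit_def fun_eq_iff algebra_simps)
  then show ?thesis
    using real_cond_exp_indep_add[OF ind N _ h]
    by (simp add: cond_exp_given_def expectation_noise)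
qed

text \<open>For each fixed \<open>x\<close> the section of \<open>G\<close> and the quadratic agree
  almost surely at \<open>v\<close>; both are continuous in \<open>w\<close>, so they coincide
  everywhere. Conversely, the quadratic is jointly continuous.\<close>

lemma conditional_profit_iff:
  "conditional_profit M p0 v u \<epsilon> l G \<longleftrightarrow> G = (\<lambda>w x. (w - p0 - l * x) * x)"
proof
  assume G: "conditional_profit M p0 v u \<epsilon> l G"
  have "(\<lambda>w. G w x) = (\<lambda>w. (w - p0 - l * x) * x)" for x
  proof (rule normal_AE_continuous_eq[OF \<sigma>v v_distributed])
    have "continuous_on UNIV (\<lambda>(w, x). G w x)"
      using G by (simp add: conditional_profit_def)
    then have "continuous_on UNIV ((\<lambda>(w, x). G w x) \<circ> (\<lambda>w. (w, x)))"
      by (intro continuous_on_compose continuous_intros) (auto intro: continuous_on_subset)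
    then show "continuous_on UNIV (\<lambda>w. G w x)" by (simp add: comp_def)
    have "AE \<omega> in M. cond_exp_given M (profit p0 v u \<epsilon> l x) v \<omega> = G (v \<omega>) x"
      using G by (simp add: conditional_profit_def)
    then show "AE \<omega> in M. G (v \<omega>) x = (v \<omega> - p0 - l * x) * x"
      using cond_exp_profit_given_v[of l x] by eventually_elim simp
  qed (intro continuous_intros)
  then show "G = (\<lambda>w x. (w - p0 - l * x) * x)" by (simp add: fun_eq_iff)
next
  assume "G = (\<lambda>w x. (w - p0 - l * x) * x)"
  then show "conditional_profit M p0 v u \<epsilon> l G"
    using cond_exp_profit_given_v
    by (auto simp: conditional_profit_def case_prod_beta intro!: continuous_intros)
qed

lemma best_response_iff:
  assumes "l > 0"
  shows "best_response M p0 v u \<epsilon> \<beta> l \<longleftrightarrow> \<beta> = 1 / (2 * l)"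
proof -
  \<comment> \<open>Since \<open>l > 0\<close>, this form of the profit turns maximising it into
    minimising the distance of \<open>x\<close> to \<open>(w - p0) / (2 * l)\<close>.\<close>
  have max: "(w - p0 - l * x) * x = (w - p0)\<^sup>2 / (4 * l) - l * (x - (w - p0) / (2 * l))\<^sup>2" for w x
    using assms by (simp add: field_simps power2_eq_square)
  have "best_response M p0 v u \<epsilon> \<beta> l \<longleftrightarrow>
      (\<forall>w x. (\<beta> * (w - p0) - (w - p0) / (2 * l))\<^sup>2 \<le> (x - (w - p0) / (2 * l))\<^sup>2)"
    using assms by (simp add: best_response_def conditional_profit_iff max)
  also have "\<dots> \<longleftrightarrow> \<beta> = 1 / (2 * l)"
  proof
    assume "\<forall>w x. (\<beta> * (w - p0) - (w - p0) / (2 * l))\<^sup>2 \<le> (x - (w - p0) / (2 * l))\<^sup>2"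
    \<comment> \<open>At \<open>w - p0 = 1\<close> the order \<open>1 / (2 * l)\<close> is the
      optimum, so the right-hand square vanishes and forces \<open>\<beta>\<close> to be that
      order.\<close>
    from this[rule_format, of "p0 + 1" "1 / (2 * l)"] show "\<beta> = 1 / (2 * l)" by simp
  qed auto
  finally show ?thesis .
qed

text \<open>Pricing and best response are two equations in \<open>\<beta>\<close> and
  \<open>l\<close>. Eliminating \<open>l\<close> leaves
  \<open>(\<beta> * \<sigma>v)\<^sup>2 = \<tau>\<^sup>2\<close>, which has a single positive
  solution.\<close>

lemma linear_equilibrium_iff:
  "linear_equilibrium M p0 v u \<epsilon> eq \<longleftrightarrow> eq = (\<tau> / \<sigma>v, \<sigma>v / (2 * \<tau>))"
proof -
  obtain \<beta> l where eq: "eq = (\<beta>, l)" by (cases eq)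
  have "linear_equilibrium M p0 v u \<epsilon> eq \<longleftrightarrow>
      0 < \<beta> \<and> 0 < l \<and> l = \<beta> * \<sigma>v\<^sup>2 / (\<beta>\<^sup>2 * \<sigma>v\<^sup>2 + \<tau>\<^sup>2) \<and> \<beta> = 1 / (2 * l)"
    by (auto simp: eq linear_equilibrium_def rational_pricing_iff best_response_iff)
  also have "\<dots> \<longleftrightarrow> \<beta> = \<tau> / \<sigma>v \<and> l = \<sigma>v / (2 * \<tau>)"
  proof
    assume "0 < \<beta> \<and> 0 < l \<and> l = \<beta> * \<sigma>v\<^sup>2 / (\<beta>\<^sup>2 * \<sigma>v\<^sup>2 + \<tau>\<^sup>2) \<and> \<beta> = 1 / (2 * l)"
    then have \<beta>: "0 < \<beta>" and "0 < l" and pricing: "l = \<beta> * \<sigma>v\<^sup>2 / (\<beta>\<^sup>2 * \<sigma>v\<^sup>2 + \<tau>\<^sup>2)"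
      and response: "\<beta> = 1 / (2 * l)" by blast+
    have l: "l = 1 / (2 * \<beta>)" by (simp add: response)
    have "0 < \<beta>\<^sup>2 * \<sigma>v\<^sup>2 + \<tau>\<^sup>2" using \<tau>_pos by (simp add: add_nonneg_pos)
    then have "l * (\<beta>\<^sup>2 * \<sigma>v\<^sup>2 + \<tau>\<^sup>2) = \<beta> * \<sigma>v\<^sup>2"
      by (subst pricing) simp
    \<comment> \<open>Inserting \<open>l = 1 / (2 * \<beta>)\<close> gives \<open>\<beta>\<^sup>2 *
      \<sigma>v\<^sup>2 + \<tau>\<^sup>2 = 2 * \<beta>\<^sup>2 * \<sigma>v\<^sup>2\<close>: signal
      and noise contribute equal variance to the flow.\<close>
    then have "(\<beta> * \<sigma>v)\<^sup>2 = \<tau>\<^sup>2"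
      using \<beta> by (simp add: l field_simps power2_eq_square)
    then have "\<beta> * \<sigma>v = \<tau>"
      using \<beta> \<sigma>v \<tau>_pos by (simp add: power2_eq_iff_nonneg)
    then have "\<beta> = \<tau> / \<sigma>v" using \<sigma>v by (simp add: field_simps)
    with l show "\<beta> = \<tau> / \<sigma>v \<and> l = \<sigma>v / (2 * \<tau>)" by simp
  next
    assume *: "\<beta> = \<tau> / \<sigma>v \<and> l = \<sigma>v / (2 * \<tau>)"
    then have "\<beta>\<^sup>2 * \<sigma>v\<^sup>2 + \<tau>\<^sup>2 = 2 * \<tau>\<^sup>2" using \<sigma>v by (simp add: power_divide)
    moreover have "\<beta> * \<sigma>v\<^sup>2 = \<tau> * \<sigma>v" using * \<sigma>v by (simp add: power2_eq_square)
    ultimately have "\<beta> * \<sigma>v\<^sup>2 / (\<beta>\<^sup>2 * \<sigma>v\<^sup>2 + \<tau>\<^sup>2) = l"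
      using * \<tau>_pos by (simp add: power2_eq_square)
    then show "0 < \<beta> \<and> 0 < l \<and> l = \<beta> * \<sigma>v\<^sup>2 / (\<beta>\<^sup>2 * \<sigma>v\<^sup>2 + \<tau>\<^sup>2) \<and> \<beta> = 1 / (2 * l)"
      using * \<sigma>v \<tau>_pos by simp
  qed
  finally show ?thesis by (simp add: eq)
qed

end

theorem theorem1:
  fixes M :: "'a measure" and p0 \<sigma>v \<sigma>u \<sigma>e :: real and v u \<epsilon> :: "'a \<Rightarrow> real"
  assumes "\<sigma>v > 0" and "\<sigma>u > 0" and "\<sigma>e \<ge> 0"
    and "kyle_model M p0 \<sigma>v \<sigma>u \<sigma>e v u \<epsilon>"
  shows "(\<exists>!eq. linear_equilibrium M p0 v u \<epsilon> eq) \<and>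
         linear_equilibrium M p0 v u \<epsilon>
           (sqrt (\<sigma>u\<^sup>2 + \<sigma>e\<^sup>2) / \<sigma>v, \<sigma>v / (2 * sqrt (\<sigma>u\<^sup>2 + \<sigma>e\<^sup>2)))"
proof -
  interpret nondegenerate_kyle_model M p0 \<sigma>v \<sigma>u \<sigma>e v u \<epsilon>
    using assms by (simp add: nondegenerate_kyle_model_def nondegenerate_kyle_model_axioms_def)
  show ?thesis
    by (simp add: linear_equilibrium_iff \<tau>_def)
qed

end
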